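(* Let $G$ be a $BSP$-group satisfying $2\in\pi(G)$. Then $G$ is a locally finite group.
   Context: For a periodic group $G$, $\pi(G)$ denotes the set of all primes dividing the order of some element of $G$. A group $G$ is called a $BSP$-group if each element of $G$ has (finite) prime power order (the identity, of order $1$, is allowed) and for each $p\in\pi(G)$ there exists a positive integer $v_p$ such that each finite $p$-subgroup of $G$ has order $p^j\leq p^{v_p}$. A group is locally finite if each of its finitely generated subgroups is finite. *)

theory Defs
  imports "HOL-Algebra.Algebra"
begin

text \<open>
  \<open>prime\<close> is qualified because HOL-Algebra shadows it with a monoid-relative notion.
  In HOL-Algebra \<^term>\<open>group.ord G x\<close> is \<open>0\<close> when \<open>x\<close> has infinite order.
  The condition \<open>group.ord G x \<noteq> 0\<close> keeps such elements, whose order every prime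
  divides formally, from contributing; it is vacuous for a periodic group.
\<close>

definition group_primes :: "('a, 'b) monoid_scheme \<Rightarrow> nat set" where
  "group_primes G =
     {p. Factorial_Ring.prime p \<and> (\<exists>x \<in> carrier G. group.ord G x \<noteq> 0 \<and> p dvd group.ord G x)}"

definition p_subgroup :: "nat \<Rightarrow> 'a set \<Rightarrow> ('a, 'b) monoid_scheme \<Rightarrow> bool" where
  "p_subgroup p H G \<longleftrightarrow> subgroup H G \<and> (\<forall>x \<in> H. \<exists>k. group.ord G x = p ^ k)"

text \<open>
  The exponent \<open>n = 0\<close> below admits the identity.  The bound \<open>v\<close> may depend on \<open>p\<close>
  but is uniform over all finite \<open>p\<close>-subgroups.
\<close>

definition BSP_group :: "('a, 'b) monoid_scheme \<Rightarrow> bool" where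
  "BSP_group G \<longleftrightarrow>
     group G \<and>
     (\<forall>x \<in> carrier G. \<exists>p n. Factorial_Ring.prime p \<and> group.ord G x = p ^ n) \<and>
     (\<forall>p \<in> group_primes G. \<exists>v > 0. \<forall>H.
        p_subgroup p H G \<and> finite H \<longrightarrow> (\<exists>j. card H = p ^ j \<and> p ^ j \<le> p ^ v))"

definition finitely_generated_subgroup :: "'a set \<Rightarrow> ('a, 'b) monoid_scheme \<Rightarrow> bool" where
  "finitely_generated_subgroup H G \<longleftrightarrow>
     subgroup H G \<and> (\<exists>S. finite S \<and> S \<subseteq> carrier G \<and> H = generate G S)"

definition locally_finite_group :: "('a, 'b) monoid_scheme \<Rightarrow> bool" where
  "locally_finite_group G \<longleftrightarrow>
     group G \<and> (\<forall>H. finitely_generated_subgroup H G \<longrightarrow> finite H)"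

end

theory Submission
  imports Defs
begin

text \<open>
  The group \<open>G\<close> turns out to be finite, which is more than local finiteness.  Since every
  element has prime power order, the centralizer of a nontrivial \<open>p\<close>-element consists of
  \<open>p\<close>-elements.  The proof rests on two finiteness facts about centralizers and on a counting
  argument in the spirit of Brauer and Fowler, in which finitely many replaces few.

  First, the centralizer of an involution is finite (\<open>finite_centralizer_involution\<close>).
  Otherwise some finite \<open>2\<close>-subgroup \<open>F\<close> containing the involution is maximal among those with
  infinite centralizer \<open>C\<close>.  Then \<open>C\<close> is a \<open>2\<close>-group in which every element outside the
  finite central subgroup \<open>F \<inter> C\<close> has a finite centralizer.  Two involutions of a \<open>2\<close>-group
  always commute with a common involution; applied modulo \<open>F \<inter> C\<close>, this leaves room for only
  finitely many conjugates of a given one, so \<open>C\<close> is finite after all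
  (\<open>finite_if_central_quotient_almost_regular\<close>).

  Secondly, an element \<open>y \<noteq> \<one>\<close> inverted by an involution \<open>s\<close> has a finite centralizer
  (\<open>finite_centralizer_inverted\<close>).  If \<open>y\<close> is a \<open>p\<close>-element with \<open>p\<close> odd, then \<open>s\<close> acts without
  fixed points on the \<open>p\<close>-group centralizing \<open>y\<close>, hence inverts it; so that group is abelian, and
  finite because its finite subgroups are bounded.

  Finally, let \<open>t\<close> be an involution with centralizer \<open>H\<close> and suppose that \<open>G\<close> is infinite.
  For all but finitely many \<open>x\<close> the product of \<open>t\<close> and its conjugate by \<open>x\<close> has odd order: when
  the order is even, both involutions commute with a third one, and finiteness of the
  centralizers leaves finitely many conjugates.  When it is odd, some involution \<open>u\<close>
  carries \<open>t\<close> to that conjugate, and \<open>x = u \<otimes> h\<close> with \<open>h \<in> H\<close>.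
  Now fix \<open>g \<notin> H\<close> and let \<open>s\<close> run through the infinitely many conjugates of \<open>t\<close>.  Almost always
  \<open>s \<otimes> g = u \<otimes> h\<close> as above, which says that \<open>s\<close> inverts \<open>g \<otimes> inv h\<close>.  As \<open>H\<close> is finite, a single
  element \<open>y = g \<otimes> inv h \<noteq> \<one>\<close> is inverted by infinitely many involutions.  The products of any two
  of them centralize \<open>y\<close>, contrary to the second fact.
\<close>

section \<open>Centralizers\<close>

context group
begin

definition centralizer :: "'a set \<Rightarrow> 'a set" where
  "centralizer A = {c \<in> carrier G. \<forall>x \<in> A. c \<otimes> x = x \<otimes> c}"

lemma inv_cancel_left: "x \<in> carrier G \<Longrightarrow> y \<in> carrier G \<Longrightarrow> inv x \<otimes> (x \<otimes> y) = y"
  by (simp flip: m_assoc)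

lemma cancel_inv_left: "x \<in> carrier G \<Longrightarrow> y \<in> carrier G \<Longrightarrow> x \<otimes> (inv x \<otimes> y) = y"
  by (simp flip: m_assoc)

text \<open>Together with the default rules for inverses, these rewrite words to reduced form in the free group.\<close>

lemmas word_simps = m_assoc inv_mult_group inv_cancel_left cancel_inv_left

lemma centralizer_closed: "c \<in> centralizer A \<Longrightarrow> c \<in> carrier G"
  by (simp add: centralizer_def)

lemma centralizer_commute: "c \<in> centralizer A \<Longrightarrow> x \<in> A \<Longrightarrow> c \<otimes> x = x \<otimes> c"
  by (simp add: centralizer_def)

lemma subgroup_centralizer:
  assumes A: "A \<subseteq> carrier G"
  shows "subgroup (centralizer A) G"
proof (rule subgroupI)
  show "centralizer A \<subseteq> carrier G" by (auto simp: centralizer_def)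
  show "centralizer A \<noteq> {}" using A by (auto simp: centralizer_def intro!: exI[of _ \<one>])
next
  fix a assume a: "a \<in> centralizer A"
  have "inv a \<otimes> x = x \<otimes> inv a" if x: "x \<in> A" for x
  proof -
    have c: "a \<in> carrier G" "x \<in> carrier G" using a x A by (auto simp: centralizer_def)
    have "inv a \<otimes> x = inv a \<otimes> (x \<otimes> a) \<otimes> inv a" using c by (simp add: word_simps)
    also have "\<dots> = x \<otimes> inv a"
      using c centralizer_commute[OF a x, symmetric] by (simp add: word_simps)
    finally show ?thesis .
  qed
  then show "inv a \<in> centralizer A" using a by (simp add: centralizer_def)
next
  fix a b assume ab: "a \<in> centralizer A" "b \<in> centralizer A"
  have "a \<otimes> b \<otimes> x = x \<otimes> (a \<otimes> b)" if x: "x \<in> A" for x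
  proof -
    have c: "a \<in> carrier G" "b \<in> carrier G" "x \<in> carrier G"
      using ab x A by (auto simp: centralizer_def)
    have "a \<otimes> b \<otimes> x = (a \<otimes> x) \<otimes> b"
      using c centralizer_commute[OF ab(2) x] by (simp add: m_assoc)
    also have "\<dots> = x \<otimes> (a \<otimes> b)"
      using c centralizer_commute[OF ab(1) x] by (simp add: m_assoc)
    finally show ?thesis .
  qed
  then show "a \<otimes> b \<in> centralizer A" using ab by (simp add: centralizer_def)
qed

lemma centralizer_sym:
  assumes "x \<in> carrier G" and "c \<in> centralizer {x}"
  shows "x \<in> centralizer {c}"
  using assms by (auto simp: centralizer_def)

lemma centralizer_pow:
  assumes "y \<in> carrier G" "c \<in> centralizer {y}"
  shows "c \<in> centralizer {y [^] (n::nat)}"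
proof -
  have "y [^] n \<in> centralizer {c}"
    using subgroup_centralizer[of "{c}"] centralizer_sym[OF assms] assms
    by (induction n) (auto intro: subgroup.one_closed subgroup.m_closed simp: centralizer_closed)
  then show ?thesis using centralizer_sym assms by (blast intro: centralizer_closed)
qed

text \<open>
  Elements conjugating \<open>x\<close> to the same element lie in one coset of the centralizer of \<open>x\<close>.
  This is how finiteness passes between a group and a conjugacy class.
\<close>

lemma finite_conj_preimage:
  assumes C: "subgroup C G" and x: "x \<in> carrier G"
    and fin: "finite (C \<inter> centralizer {x})" and S: "finite S"
  shows "finite {c \<in> C. c \<otimes> x \<otimes> inv c \<in> S}"
proof -
  have one: "finite {c \<in> C. c \<otimes> x \<otimes> inv c = y}" for y
  proof (cases "{c \<in> C. c \<otimes> x \<otimes> inv c = y} = {}")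
    case True then show ?thesis by (simp only: finite.emptyI)
  next
    case False
    then obtain d where d: "d \<in> C" "d \<otimes> x \<otimes> inv d = y" by blast
    have "{c \<in> C. c \<otimes> x \<otimes> inv c = y} \<subseteq> (\<lambda>e. d \<otimes> e) ` (C \<inter> centralizer {x})"
    proof
      fix c assume "c \<in> {c \<in> C. c \<otimes> x \<otimes> inv c = y}"
      then have c: "c \<in> C" "c \<otimes> x \<otimes> inv c = d \<otimes> x \<otimes> inv d" using d by auto
      have car: "c \<in> carrier G" "d \<in> carrier G" using c d subgroup.mem_carrier[OF C] by auto
      have "inv d \<otimes> c \<otimes> x = inv d \<otimes> (c \<otimes> x \<otimes> inv c) \<otimes> c"
        using car x by (simp add: word_simps)
      also have "\<dots> = x \<otimes> (inv d \<otimes> c)"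
        unfolding c(2) using car x by (simp add: word_simps)
      finally have "inv d \<otimes> c \<in> C \<inter> centralizer {x}"
        using c d car C by (auto simp: centralizer_def subgroup.m_closed subgroup.m_inv_closed)
      moreover have "c = d \<otimes> (inv d \<otimes> c)" using car by (simp add: word_simps)
      ultimately show "c \<in> (\<lambda>e. d \<otimes> e) ` (C \<inter> centralizer {x})" by blast
    qed
    then show ?thesis using fin by (meson finite_imageI finite_subset)
  qed
  have "{c \<in> C. c \<otimes> x \<otimes> inv c \<in> S} = (\<Union>y\<in>S. {c \<in> C. c \<otimes> x \<otimes> inv c = y})" by auto
  then show ?thesis using S one by auto
qed

lemma conj_pow:
  assumes "c \<in> carrier G" "x \<in> carrier G"
  shows "(c \<otimes> x \<otimes> inv c) [^] (n::nat) = c \<otimes> x [^] n \<otimes> inv c"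
  using assms by (induction n) (simp_all add: word_simps)

section \<open>Almost regular 2-groups\<close>

text \<open>
  With \<open>Z = {\<one>}\<close> this finds the involution among the powers of a nontrivial \<open>2\<close>-element; for a
  central subgroup \<open>Z\<close> it finds an element that becomes an involution modulo \<open>Z\<close>.
\<close>

lemma last_power_of_two_outside:
  assumes x: "x \<in> carrier G" and "x \<notin> Z" and "x [^] ((2::nat) ^ k) \<in> Z"
  obtains m where "x [^] ((2::nat) ^ m) \<notin> Z"
    and "x [^] ((2::nat) ^ m) \<otimes> x [^] ((2::nat) ^ m) \<in> Z"
proof -
  define j where "j = (LEAST j. x [^] ((2::nat) ^ j) \<in> Z)"
  have j: "x [^] ((2::nat) ^ j) \<in> Z" unfolding j_def using assms(3) by (rule LeastI)
  have "j \<noteq> 0" using j assms(1,2) by (intro notI) simp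
  then obtain m where m: "j = Suc m" by (cases j) auto
  have "x [^] ((2::nat) ^ m) \<notin> Z" using not_less_Least[of m, folded j_def] m j_def
    by (metis lessI not_less_Least)
  moreover have "x [^] ((2::nat) ^ m) \<otimes> x [^] ((2::nat) ^ m) \<in> Z"
    using j x m by (simp add: nat_pow_mult mult_2)
  ultimately show thesis by (rule that)
qed

text \<open>
  Modulo \<open>Z\<close> the argument reads: two involutions \<open>r\<close> and \<open>s\<close> of a \<open>2\<close>-group generate a dihedral
  \<open>2\<close>-group, whose central involution \<open>z\<close> lies in the finite centralizer of \<open>r\<close> and has
  \<open>s\<close> in its own finite centralizer.  So given \<open>r\<close> there are finitely many possible \<open>s\<close>, in
  particular finitely many conjugates of \<open>r\<close>.  The centralizer of \<open>xZ\<close> is represented by the set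
  \<open>D x\<close> of all \<open>c\<close> that conjugate \<open>x\<close> into its own coset; it is finite because
  \<open>Z\<close> and the centralizer of \<open>x\<close> in \<open>C\<close> are.
\<close>

lemma finite_if_central_quotient_almost_regular:
  assumes C: "subgroup C G" and Z: "subgroup Z G" "finite Z" "Z \<subseteq> C"
    and central: "\<And>z c. z \<in> Z \<Longrightarrow> c \<in> C \<Longrightarrow> z \<otimes> c = c \<otimes> z"
    and reg: "\<And>x. x \<in> C - Z \<Longrightarrow> finite (C \<inter> centralizer {x})"
    and two: "\<And>x. x \<in> C \<Longrightarrow> \<exists>k. x [^] ((2::nat) ^ k) = \<one>"
  shows "finite C"
proof (cases "C \<subseteq> Z")
  case True then show ?thesis using Z finite_subset by blast
next
  case False
  have car: "x \<in> carrier G" if "x \<in> C" for x using that C by (rule subgroup.mem_carrier[rotated])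
  have pow: "x [^] (n::nat) \<in> C" if "x \<in> C" for x n
    using that C by (induction n) (auto intro: subgroup.one_closed subgroup.m_closed)
  have last: "\<exists>m. x [^] ((2::nat) ^ m) \<notin> Z \<and> x [^] ((2::nat) ^ m) \<otimes> x [^] ((2::nat) ^ m) \<in> Z"
    if x: "x \<in> C - Z" for x
  proof -
    obtain k where "x [^] ((2::nat) ^ k) = \<one>" using two[of x] x by blast
    then have "x [^] ((2::nat) ^ k) \<in> Z" using subgroup.one_closed[OF Z(1)] by simp
    then show ?thesis using last_power_of_two_outside[of x Z k] x car by (metis DiffE)
  qed
  obtain c0 where "c0 \<in> C - Z" using False by blast
  then obtain m where m: "c0 [^] ((2::nat) ^ m) \<notin> Z"
      "c0 [^] ((2::nat) ^ m) \<otimes> c0 [^] ((2::nat) ^ m) \<in> Z" using last by blast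
  define r where "r = c0 [^] ((2::nat) ^ m)"
  have r: "r \<in> C - Z" "r \<otimes> r \<in> Z" using m pow \<open>c0 \<in> C - Z\<close> by (auto simp: r_def)
  have rc: "r \<in> carrier G" using r car by blast
  define D where "D x = {c \<in> C. c \<otimes> x \<otimes> inv c \<in> (\<lambda>z. x \<otimes> z) ` Z}" for x
  have finD: "finite (D x)" if "x \<in> C - Z" for x
    unfolding D_def using that Z reg car by (intro finite_conj_preimage[OF C]) auto
  define U where "U = (\<lambda>z. r \<otimes> z) ` Z \<union> (\<Union>z \<in> D r - Z. D z)"
  have "finite U" unfolding U_def using Z(2) finD r(1) by (auto simp: D_def)
  moreover have "c \<otimes> r \<otimes> inv c \<in> U" if c: "c \<in> C" for c
  proof -
    define s where "s = c \<otimes> r \<otimes> inv c"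
    have cc: "c \<in> carrier G" using c car by blast
    have sC: "s \<in> C" unfolding s_def using c r C
      by (auto intro!: subgroup.m_closed subgroup.m_inv_closed)
    have sc: "s \<in> carrier G" using sC car by blast
    \<comment> \<open>The square of \<open>r\<close> is central, so \<open>s\<close> has the same square.  Hence \<open>r\<close> and \<open>s\<close> invert
      \<open>inv r \<otimes> s\<close> exactly, not only modulo \<open>Z\<close>.\<close>
    have "s \<otimes> s = c \<otimes> (r \<otimes> r) \<otimes> inv c" unfolding s_def using cc rc by (simp add: word_simps)
    also have "\<dots> = (r \<otimes> r) \<otimes> c \<otimes> inv c" using central[OF r(2) c] by simp
    also have "\<dots> = r \<otimes> r" using cc rc by (simp add: word_simps)
    finally have ss: "s \<otimes> s = r \<otimes> r" .
    define w where "w = inv r \<otimes> s"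
    have wC: "w \<in> C" unfolding w_def using sC r C
      by (auto intro!: subgroup.m_closed subgroup.m_inv_closed)
    have wc: "w \<in> carrier G" using wC car by blast
    have s_eq: "s = r \<otimes> w" unfolding w_def using rc sc by (simp add: word_simps)
    show ?thesis
    proof (cases "w \<in> Z")
      case True
      then show ?thesis unfolding U_def s_def[symmetric] s_eq by blast
    next
      case False
      then obtain m where m: "w [^] ((2::nat) ^ m) \<notin> Z"
        "w [^] ((2::nat) ^ m) \<otimes> w [^] ((2::nat) ^ m) \<in> Z" using last wC by blast
      define z where "z = w [^] ((2::nat) ^ m)"
      have zC: "z \<in> C" and z: "z \<notin> Z" "z \<otimes> z \<in> Z" using m pow wC by (auto simp: z_def)
      have zc: "z \<in> carrier G" using zC car by blast
      have "inv w = inv s \<otimes> (r \<otimes> r) \<otimes> inv r" unfolding w_def using rc sc by (simp add: word_simps)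
      also have "\<dots> = s \<otimes> inv r" unfolding ss[symmetric] using rc sc by (simp add: word_simps)
      finally have iw: "inv w = s \<otimes> inv r" .
      have "r \<otimes> w \<otimes> inv r = inv w" unfolding iw s_eq using rc wc by (simp add: word_simps)
      then have rz: "r \<otimes> z \<otimes> inv r = inv z"
        unfolding z_def using conj_pow[OF rc wc] by (simp add: nat_pow_inv wc)
      have "s \<otimes> w \<otimes> inv s = inv w" unfolding iw unfolding w_def using rc sc
        by (simp add: word_simps)
      then have sz: "s \<otimes> z \<otimes> inv s = inv z"
        unfolding z_def using conj_pow[OF sc wc] by (simp add: nat_pow_inv wc)
      have izz: "inv (z \<otimes> z) \<in> Z" using z Z(1) by (simp add: subgroup.m_inv_closed)
      have iz: "inv z = z \<otimes> inv (z \<otimes> z)" using zc by (simp add: word_simps)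
      have "s \<in> D z" unfolding D_def using sC sz iz izz by auto
      moreover have "z \<otimes> r \<otimes> inv z = r \<otimes> inv (z \<otimes> z)"
      proof -
        have "r \<otimes> inv z = inv (r \<otimes> z \<otimes> inv r) \<otimes> r" using rc zc by (simp add: word_simps)
        also have "\<dots> = z \<otimes> r" unfolding rz using rc zc by simp
        finally have "z \<otimes> r = r \<otimes> inv z" by simp
        then show ?thesis using rc zc by (simp add: word_simps)
      qed
      then have "z \<in> D r" unfolding D_def using zC izz by auto
      ultimately show ?thesis unfolding U_def s_def[symmetric] using z(1) by blast
    qed
  qed
  ultimately have "finite {c \<in> C. c \<otimes> r \<otimes> inv c \<in> U}"
    using finite_conj_preimage[OF C rc] reg[OF r(1)] by blast
  moreover have "{c \<in> C. c \<otimes> r \<otimes> inv c \<in> U} = C"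
    using \<open>\<And>c. c \<in> C \<Longrightarrow> c \<otimes> r \<otimes> inv c \<in> U\<close> by blast
  ultimately show ?thesis by simp
qed


section \<open>Finite p-subgroups\<close>

lemma centralizer_generate:
  assumes A: "A \<subseteq> carrier G"
  shows "centralizer (generate G A) = centralizer A"
proof
  show "centralizer (generate G A) \<subseteq> centralizer A"
    using generate.incl[of _ A G] by (auto simp: centralizer_def)
  show "centralizer A \<subseteq> centralizer (generate G A)"
  proof
    fix c assume c: "c \<in> centralizer A"
    then have cc: "c \<in> carrier G" by (rule centralizer_closed)
    have "A \<subseteq> centralizer {c}" using c A by (auto simp: centralizer_def)
    then have "generate G A \<subseteq> centralizer {c}"
      using subgroup_centralizer[of "{c}"] cc by (intro generate_subgroup_incl) auto
    then show "c \<in> centralizer (generate G A)" using cc by (auto simp: centralizer_def)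
  qed
qed

lemma ord_prime_power_iff:
  assumes "Factorial_Ring.prime p" "x \<in> carrier G"
  shows "(\<exists>k. ord x = p ^ k) \<longleftrightarrow> (\<exists>k. x [^] (p ^ k) = \<one>)"
  using assms by (metis divides_primepow_nat dvd_refl pow_eq_id)

text \<open>
  The product of \<open>F\<close> and the cyclic group generated by \<open>x\<close> is a subgroup, because the factors
  commute, and it is a finite set of \<open>p\<close>-elements.  This step makes it possible to exploit
  the maximality of a finite \<open>p\<close>-subgroup.
\<close>

lemma p_subgroup_adjoin_centralizing:
  assumes p: "Factorial_Ring.prime p" and F: "p_subgroup p F G" "finite F"
    and x: "x \<in> centralizer F" "ord x = p ^ n"
  shows "p_subgroup p (generate G (insert x F)) G" "finite (generate G (insert x F))"
proof -
  have sF: "subgroup F G" using F(1) by (simp add: p_subgroup_def)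
  have Fc: "F \<subseteq> carrier G" using sF by (rule subgroup.subset)
  have xc: "x \<in> carrier G" using x(1) by (rule centralizer_closed)
  let ?X = "generate G {x}"
  have sX: "subgroup ?X G" using xc by (intro generate_is_subgroup) auto
  have Xc: "?X \<subseteq> carrier G" using sX by (rule subgroup.subset)
  have "ord x \<noteq> 0" using x(2) p by (simp add: prime_gt_0_nat)
  then have X: "?X = {x [^] k | k. k \<in> (UNIV :: nat set)}" by (rule generate_pow_nat[OF xc])
  have "finite ?X" using \<open>ord x \<noteq> 0\<close> generate_pow_card[OF xc] by (metis card.infinite)
  have XF: "?X \<subseteq> centralizer F"
    using x(1) subgroup_centralizer[OF Fc] by (intro generate_subgroup_incl) auto
  have comm: "f \<otimes> y = y \<otimes> f" if "f \<in> F" "y \<in> ?X" for f y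
    using centralizer_commute[OF subsetD[OF XF that(2)] that(1)] by (rule sym)
  let ?K = "F <#> ?X"
  have memK: "f \<otimes> y \<in> ?K" if "f \<in> F" "y \<in> ?X" for f y
    using that by (auto simp: set_mult_def)
  have sK: "subgroup ?K G"
  proof (rule subgroupI)
    show "?K \<subseteq> carrier G" using Fc Xc by (rule set_mult_closed)
    show "?K \<noteq> {}"
      using subgroup.one_closed[OF sF] subgroup.one_closed[OF sX] by (auto simp: set_mult_def)
  next
    fix a assume "a \<in> ?K"
    then obtain f y where fy: "f \<in> F" "y \<in> ?X" "a = f \<otimes> y" by (auto simp: set_mult_def)
    then have "inv a = inv f \<otimes> inv y" using comm Fc Xc by (metis inv_mult_group subsetD)
    then show "inv a \<in> ?K" using memK[OF subgroup.m_inv_closed[OF sF fy(1)] subgroup.m_inv_closed[OF sX fy(2)]] by simp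
  next
    fix a b assume "a \<in> ?K" "b \<in> ?K"
    then obtain f y g z where fy: "f \<in> F" "y \<in> ?X" "a = f \<otimes> y" "g \<in> F" "z \<in> ?X" "b = g \<otimes> z"
      by (auto simp: set_mult_def)
    have c: "f \<in> carrier G" "y \<in> carrier G" "g \<in> carrier G" "z \<in> carrier G"
      using fy Fc Xc by auto
    have "a \<otimes> b = f \<otimes> (y \<otimes> g) \<otimes> z" using fy c by (simp add: m_assoc)
    also have "\<dots> = (f \<otimes> g) \<otimes> (y \<otimes> z)"
      using comm[OF fy(4,2), symmetric] c by (simp add: m_assoc)
    finally show "a \<otimes> b \<in> ?K"
      using memK[OF subgroup.m_closed[OF sF fy(1,4)] subgroup.m_closed[OF sX fy(2,5)]] by simp
  qed
  have pK: "\<exists>k. ord a = p ^ k" if "a \<in> ?K" for a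
  proof -
    from that obtain f y where fy: "f \<in> F" "y \<in> ?X" "a = f \<otimes> y" by (auto simp: set_mult_def)
    have c: "f \<in> carrier G" "y \<in> carrier G" using fy Fc Xc by auto
    obtain k where k: "f [^] (p ^ k) = \<one>"
      using F(1) fy(1) ord_prime_power_iff[OF p c(1)] by (auto simp: p_subgroup_def)
    have y: "y [^] (p ^ n) = \<one>"
    proof -
      obtain i :: nat where "y = x [^] i" using fy(2) X by auto
      then have "y [^] (p ^ n) = (x [^] (p ^ n)) [^] i"
        using xc by (simp add: nat_pow_pow mult.commute)
      then show ?thesis using xc x(2) by (metis nat_pow_one pow_ord_eq_1)
    qed
    have "a [^] (p ^ (k + n)) = f [^] (p ^ (k + n)) \<otimes> y [^] (p ^ (k + n))"
      unfolding fy(3) using comm[OF fy(1,2)] c by (rule pow_mult_distrib)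
    also have "f [^] (p ^ (k + n)) = (f [^] (p ^ k)) [^] (p ^ n)"
      using c by (simp add: nat_pow_pow power_add)
    also have "y [^] (p ^ (k + n)) = (y [^] (p ^ n)) [^] (p ^ k)"
      using c by (simp add: nat_pow_pow power_add mult.commute)
    finally have "a [^] (p ^ (k + n)) = \<one>" using k y by simp
    then show ?thesis using ord_prime_power_iff[OF p] subgroup.mem_carrier[OF sK that] by blast
  qed
  have "insert x F \<subseteq> ?K"
  proof
    fix z assume "z \<in> insert x F"
    moreover have "x = \<one> \<otimes> x" "x \<in> ?X" "\<one> \<in> ?X" "\<one> \<in> F"
      using xc subgroup.one_closed sF sX by (auto intro: generate.incl generate.one)
    moreover have "z \<in> F \<Longrightarrow> z = z \<otimes> \<one>" using Fc by auto
    ultimately show "z \<in> ?K" using memK[of \<one> x] memK[of z \<one>] by auto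
  qed
  then have sub: "generate G (insert x F) \<subseteq> ?K" using sK by (rule generate_subgroup_incl)
  have "finite ?K" using F(2) \<open>finite ?X\<close> by (simp add: set_mult_def)
  then show "finite (generate G (insert x F))" using sub finite_subset by blast
  have "subgroup (generate G (insert x F)) G" using xc Fc by (intro generate_is_subgroup) auto
  then show "p_subgroup p (generate G (insert x F)) G"
    using pK sub by (auto simp: p_subgroup_def)
qed

lemma p_subgroup_trivial: "p_subgroup p {\<one>} G"
  by (auto simp: p_subgroup_def triv_subgroup intro: exI[of _ 0])

text \<open>
  In the abelian case a finite \<open>p\<close>-subgroup of maximal order absorbs every element.
\<close>

lemma finite_abelian_p_subgroup:
  assumes p: "Factorial_Ring.prime p" and P: "p_subgroup p P G"
    and comm: "\<And>x y. x \<in> P \<Longrightarrow> y \<in> P \<Longrightarrow> x \<otimes> y = y \<otimes> x"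
    and bound: "\<And>F. p_subgroup p F G \<Longrightarrow> finite F \<Longrightarrow> card F \<le> N"
  shows "finite P"
proof -
  let ?Q = "\<lambda>F. p_subgroup p F G \<and> finite F \<and> F \<subseteq> P"
  have sP: "subgroup P G" using P by (simp add: p_subgroup_def)
  have "?Q {\<one>}" using p_subgroup_trivial subgroup.one_closed[OF sP] by auto
  moreover have "\<forall>F. ?Q F \<longrightarrow> card F < Suc N" using bound by (simp add: less_Suc_eq_le)
  ultimately obtain F where F: "?Q F" and max: "\<forall>E. ?Q E \<longrightarrow> card E \<le> card F"
    using ex_has_greatest_nat[of ?Q "{\<one>}" card "Suc N"] by blast
  have "x \<in> F" if x: "x \<in> P" for x
  proof -
    have xF: "x \<in> centralizer F"
      using x F comm subgroup.mem_carrier[OF sP] by (auto simp: centralizer_def)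
    obtain n where n: "ord x = p ^ n" using P x by (auto simp: p_subgroup_def)
    let ?E = "generate G (insert x F)"
    have "?Q ?E"
      using p_subgroup_adjoin_centralizing[OF p _ _ xF n] F x sP
        generate_subgroup_incl[of "insert x F" P] by auto
    then have "card ?E \<le> card F" "finite ?E" using max by auto
    moreover have "insert x F \<subseteq> ?E" by (auto intro: generate.incl)
    ultimately show "x \<in> F" by (metis card_seteq insert_subset)
  qed
  then show ?thesis using F by (metis finite_subset subsetI)
qed

section \<open>Products of two involutions\<close>

lemma inv_involution: "s \<in> carrier G \<Longrightarrow> s \<otimes> s = \<one> \<Longrightarrow> inv s = s"
  by (rule inv_equality)

lemma involution_inverts_product:
  assumes s: "s \<in> carrier G" "s \<otimes> s = \<one>" and r: "r \<in> carrier G" "r \<otimes> r = \<one>"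
  shows "s \<otimes> (s \<otimes> r) [^] (n::nat) \<otimes> inv s = inv ((s \<otimes> r) [^] n)"
proof -
  have i: "inv s = s" "inv r = r" using s r by (simp_all add: inv_involution)
  have "s \<otimes> (s \<otimes> r) \<otimes> inv s = (s \<otimes> s) \<otimes> (r \<otimes> inv s)" using s(1) r(1) by (simp add: m_assoc)
  also have "\<dots> = inv (s \<otimes> r)" using s r by (simp add: i inv_mult_group)
  finally show ?thesis using conj_pow[of s "s \<otimes> r" n] s r by (simp add: nat_pow_inv)
qed

text \<open>
  Write \<open>w = s \<otimes> r\<close> and \<open>v = w [^] k\<close>.  As \<open>s\<close> inverts \<open>w\<close>, conjugating \<open>s\<close> by \<open>v\<close> multiplies it by the
  inverse of \<open>v \<otimes> v\<close>, which is \<open>w\<close> because \<open>v \<otimes> v \<otimes> w = \<one>\<close>.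
\<close>

lemma involutions_conjugate_if_odd_product:
  assumes s: "s \<in> carrier G" "s \<otimes> s = \<one>" and r: "r \<in> carrier G" "r \<otimes> r = \<one>"
    and ord: "ord (s \<otimes> r) = Suc (2 * k)"
  shows "(s \<otimes> r) [^] k \<otimes> s \<otimes> inv ((s \<otimes> r) [^] k) = r"
proof -
  define w where "w = s \<otimes> r"
  define v where "v = w [^] k"
  have c: "w \<in> carrier G" "v \<in> carrier G" using s r by (auto simp: w_def v_def)
  have i: "inv s = s" using s by (simp add: inv_involution)
  have "s \<otimes> v \<otimes> inv s = inv v"
    unfolding v_def w_def by (rule involution_inverts_product[OF s r])
  then have "inv (s \<otimes> v \<otimes> inv s) = inv (inv v)" by simp
  then have "s \<otimes> inv v \<otimes> s = v" using s c by (simp add: word_simps i)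
  then have "v \<otimes> s = s \<otimes> inv v" using s c by (metis i inv_closed inv_solve_right m_closed)
  then have 1: "v \<otimes> s \<otimes> inv v = s \<otimes> inv (v \<otimes> v)" using s c by (simp add: word_simps)
  have "v \<otimes> v \<otimes> w = w [^] Suc (2 * k)" using c by (simp add: v_def nat_pow_mult mult_2)
  also have "\<dots> = \<one>" using ord c by (metis pow_ord_eq_1 w_def)
  finally have "w = inv (v \<otimes> v)" using c by (metis inv_equality inv_inv inv_comm m_closed)
  then have "s \<otimes> inv (v \<otimes> v) = s \<otimes> (s \<otimes> r)" by (simp add: w_def)
  also have "\<dots> = (s \<otimes> s) \<otimes> r" using s(1) r(1) by (simp add: m_assoc)
  finally show ?thesis using 1 s r by (simp add: v_def w_def)
qed

end

section \<open>Centralizers in groups of elements of prime power order\<close>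

text \<open>
  Such groups are known as EPPO groups.  The bound is required for every prime here: for a prime
  that divides no element order, the only \<open>p\<close>-subgroup is trivial.
\<close>

locale bounded_eppo_group = group +
  assumes ord_prime_power:
      "x \<in> carrier G \<Longrightarrow> \<exists>p n. Factorial_Ring.prime p \<and> ord x = p ^ n"
    and p_subgroups_bounded:
      "Factorial_Ring.prime p \<Longrightarrow> \<exists>N. \<forall>F. p_subgroup p F G \<and> finite F \<longrightarrow> card F \<le> N"
begin

text \<open>
  If the primes differed, the order of \<open>x \<otimes> y\<close> would be divisible by both of them.
\<close>

lemma prime_of_commuting:
  assumes p: "Factorial_Ring.prime p" "ord x = p ^ a" and q: "Factorial_Ring.prime q" "ord y = q ^ b"
    and x: "x \<in> carrier G" "x \<noteq> \<one>" and y: "y \<in> carrier G" "y \<noteq> \<one>"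
    and comm: "x \<otimes> y = y \<otimes> x"
  shows "p = q"
proof (rule ccontr)
  assume "p \<noteq> q"
  obtain r c where r: "Factorial_Ring.prime r" "ord (x \<otimes> y) = r ^ c"
    using ord_prime_power x y by blast
  \<comment> \<open>Stated for renamed variables so that it applies to \<open>x\<close> and \<open>y\<close> in either order.\<close>
  have *: "p' = r" if "Factorial_Ring.prime p'" "ord x' = p' ^ a'" "Factorial_Ring.prime q'" "ord y' = q' ^ b'"
    "x' \<in> carrier G" "x' \<noteq> \<one>" "y' \<in> carrier G" "x' \<otimes> y' = y' \<otimes> x'" "p' \<noteq> q'" "x' \<otimes> y' = x \<otimes> y"
    for p' q' x' y' a' b'
  proof -
    have "(x' \<otimes> y') [^] (r ^ c * q' ^ b') = \<one>"
      using that r x y by (simp add: pow_eq_id)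
    moreover have "y' [^] (r ^ c * q' ^ b') = \<one>" using that by (simp add: pow_eq_id)
    ultimately have "x' [^] (r ^ c * q' ^ b') = \<one>"
      using pow_mult_distrib[of x' y' "r ^ c * q' ^ b'"] that by simp
    then have "p' ^ a' dvd r ^ c * q' ^ b'" using that by (simp add: pow_eq_id)
    moreover have "a' \<noteq> 0" using that ord_eq_1[of x'] by (intro notI) simp
    ultimately have "p' dvd r ^ c * q' ^ b'" by (meson dvd_power dvd_trans neq0_conv)
    then have "p' dvd r \<or> p' dvd q'" using that(1)
      by (metis prime_dvd_mult_iff prime_dvd_power)
    then show ?thesis using that r(1) by (metis primes_dvd_imp_eq)
  qed
  have "p = r" using *[OF p q x y(1) comm \<open>p \<noteq> q\<close>] by simp
  moreover have "q = r" using *[OF q p y x(1)] comm \<open>p \<noteq> q\<close> by metis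
  ultimately show False using \<open>p \<noteq> q\<close> by simp
qed

lemma centralizer_p_elements:
  assumes p: "Factorial_Ring.prime p" "ord y = p ^ a" and y: "y \<in> carrier G" "y \<noteq> \<one>"
    and c: "c \<in> centralizer {y}"
  shows "\<exists>k. ord c = p ^ k"
proof (cases "c = \<one>")
  case True then show ?thesis by (auto intro: exI[of _ 0])
next
  case False
  have cc: "c \<in> carrier G" using c by (rule centralizer_closed)
  obtain q b where q: "Factorial_Ring.prime q" "ord c = q ^ b" using ord_prime_power cc by blast
  have "y \<otimes> c = c \<otimes> y" using c by (simp add: centralizer_def)
  then have "p = q" using prime_of_commuting[OF p q y cc False] by blast
  then show ?thesis using q by blast
qed

text \<open>
  A finite \<open>2\<close>-subgroup \<open>F\<close> of largest order among those that contain \<open>t\<close> and have an infinite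
  centralizer \<open>C\<close> reduces the claim to almost regular \<open>2\<close>-groups.  Containing \<open>t\<close> makes \<open>C\<close> a
  \<open>2\<close>-group, and adjoining to \<open>F\<close> an element of \<open>C\<close> outside \<open>F\<close> must make the centralizer finite.
\<close>

lemma finite_centralizer_involution:
  assumes t: "t \<in> carrier G" "t \<noteq> \<one>" "t \<otimes> t = \<one>"
  shows "finite (centralizer {t})"
proof (rule ccontr)
  assume inf: "infinite (centralizer {t})"
  have p2: "Factorial_Ring.prime (2::nat)" by simp
  obtain N where N: "\<And>F. p_subgroup 2 F G \<Longrightarrow> finite F \<Longrightarrow> card F \<le> N"
    using p_subgroups_bounded[OF p2] by blast
  have "t [^] (2 ^ 1 :: nat) = \<one>" using t by (simp add: numeral_2_eq_2)
  then obtain n where ot: "ord t = 2 ^ n" using ord_prime_power_iff[OF p2 t(1)] by blast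
  let ?Q = "\<lambda>F. p_subgroup 2 F G \<and> finite F \<and> t \<in> F \<and> infinite (centralizer F)"
  let ?F0 = "generate G (insert t {\<one>})"
  have "t \<in> centralizer {\<one>}" using t by (simp add: centralizer_def)
  moreover have "centralizer ?F0 = centralizer {t}"
    using t by (subst centralizer_generate) (auto simp: centralizer_def)
  ultimately have "?Q ?F0"
    using p_subgroup_adjoin_centralizing[OF p2 p_subgroup_trivial _ _ ot] inf
    by (auto intro: generate.incl)
  moreover have "\<forall>F. ?Q F \<longrightarrow> card F < Suc N" using N by (simp add: less_Suc_eq_le)
  ultimately obtain F where F: "?Q F" and max: "\<forall>E. ?Q E \<longrightarrow> card E \<le> card F"
    using ex_has_greatest_nat[of ?Q ?F0 card "Suc N"] by blast
  have sF: "subgroup F G" using F by (simp add: p_subgroup_def)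
  then have Fc: "F \<subseteq> carrier G" by (rule subgroup.subset)
  let ?C = "centralizer F"
  have sC: "subgroup ?C G" using Fc by (rule subgroup_centralizer)
  have ordC: "\<exists>k. ord x = 2 ^ k" if "x \<in> ?C" for x
    using that F by (intro centralizer_p_elements[OF p2 ot t(1,2)]) (auto simp: centralizer_def)
  have "finite ?C"
  proof (rule finite_if_central_quotient_almost_regular[OF sC, of "F \<inter> ?C"])
    show "subgroup (F \<inter> ?C) G" using sF sC by (rule subgroups_Inter_pair)
    show "finite (F \<inter> ?C)" using F by simp
    show "F \<inter> ?C \<subseteq> ?C" by simp
    show "z \<otimes> c = c \<otimes> z" if "z \<in> F \<inter> ?C" "c \<in> ?C" for z c
      using that by (simp add: centralizer_def)
    show "\<exists>k. x [^] ((2::nat) ^ k) = \<one>" if "x \<in> ?C" for x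
      using ordC[OF that] ord_prime_power_iff[OF p2 centralizer_closed[OF that]] by simp
    show "finite (?C \<inter> centralizer {x})" if x: "x \<in> ?C - (F \<inter> ?C)" for x
    proof (rule ccontr)
      assume inf: "infinite (?C \<inter> centralizer {x})"
      have xC: "x \<in> ?C" "x \<notin> F" using x by auto
      obtain k where k: "ord x = 2 ^ k" using ordC xC by blast
      let ?E = "generate G (insert x F)"
      have "centralizer ?E = ?C \<inter> centralizer {x}"
        using Fc centralizer_closed[OF xC(1)]
        by (subst centralizer_generate) (auto simp: centralizer_def)
      moreover have sub: "insert x F \<subseteq> ?E" by (auto intro: generate.incl)
      moreover have E: "p_subgroup 2 ?E G" "finite ?E"
        using p_subgroup_adjoin_centralizing[OF p2 _ _ xC(1) k] F by auto
      ultimately have "?Q ?E" using inf F by auto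
      then have "card ?E \<le> card F" using max by blast
      then show False using sub E(2) xC(2) by (metis card_seteq insert_subset)
    qed
  qed
  then show False using F by simp
qed

text \<open>
  A \<open>2\<close>-element has an involution among its powers, whose centralizer contains its own.
  For odd \<open>p\<close> the group \<open>P\<close> centralizing \<open>y\<close> is a \<open>p\<close>-group normalized by \<open>s\<close>, and no nontrivial
  element of \<open>P\<close> commutes with \<open>s\<close>.  As in finite groups, a fixed-point-free involution inverts
  everything.  Finite groups allow a proof by counting the elements of the form
  \<open>s \<otimes> c \<otimes> s \<otimes> inv c\<close>; here \<open>c\<close> is instead compared with the power of this element that conjugates
  \<open>s\<close> in the same way.
\<close>

lemma finite_centralizer_inverted:
  assumes s: "s \<in> carrier G" "s \<noteq> \<one>" "s \<otimes> s = \<one>"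
    and y: "y \<in> carrier G" "y \<noteq> \<one>" and inverts: "s \<otimes> y \<otimes> inv s = inv y"
  shows "finite (centralizer {y})"
proof -
  obtain p n where p: "Factorial_Ring.prime p" "ord y = p ^ n" using ord_prime_power y(1) by blast
  let ?P = "centralizer {y}"
  have sP: "subgroup ?P G" using y by (intro subgroup_centralizer) auto
  have ordP: "\<exists>k. ord c = p ^ k" if "c \<in> ?P" for c
    using that by (rule centralizer_p_elements[OF p y])
  have ppP: "p_subgroup p ?P G" using sP ordP by (simp add: p_subgroup_def)
  show ?thesis
  proof (cases "p = 2")
    case True
    have "y [^] ((2::nat) ^ n) \<in> {\<one>}" using p True y by (metis pow_ord_eq_1 singletonI)
    then obtain m where "y [^] ((2::nat) ^ m) \<notin> {\<one>}"
      "y [^] ((2::nat) ^ m) \<otimes> y [^] ((2::nat) ^ m) \<in> {\<one>}"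
      using last_power_of_two_outside[of y "{\<one>}" n] y by auto
    then have "finite (centralizer {y [^] ((2::nat) ^ m)})"
      using y by (intro finite_centralizer_involution) auto
    moreover have "?P \<subseteq> centralizer {y [^] ((2::nat) ^ m)}" using centralizer_pow y by blast
    ultimately show ?thesis by (rule finite_subset[rotated])
  next
    case False
    have si: "inv s = s" using s by (simp add: inv_involution)
    have "s [^] (2 ^ 1 :: nat) = \<one>" using s by (simp add: numeral_2_eq_2)
    then have ord_s: "\<exists>k. ord s = 2 ^ k" using ord_prime_power_iff[OF two_is_prime_nat s(1)] by blast
    have inv_all: "s \<otimes> c \<otimes> s = inv c" if c: "c \<in> ?P" for c
    proof -
      have cc: "c \<in> carrier G" using c by (rule centralizer_closed)
      define r where "r = c \<otimes> s \<otimes> inv c"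
      have r: "r \<in> carrier G" "r \<otimes> r = \<one>"
      proof -
        show "r \<in> carrier G" using cc s by (simp add: r_def)
        have "r \<otimes> r = c \<otimes> (s \<otimes> s) \<otimes> inv c" using cc s(1) by (simp add: r_def word_simps)
        then show "r \<otimes> r = \<one>" using cc s(3) by simp
      qed
      have "s \<otimes> c \<otimes> inv s \<in> ?P"
      proof -
        have "s \<otimes> c \<otimes> inv s \<otimes> inv y = s \<otimes> (c \<otimes> y) \<otimes> inv s"
          unfolding inverts[symmetric] using s(1) cc y by (simp add: word_simps)
        also have "\<dots> = s \<otimes> (y \<otimes> c) \<otimes> inv s" using c by (simp add: centralizer_def)
        also have "\<dots> = inv y \<otimes> (s \<otimes> c \<otimes> inv s)"
          unfolding inverts[symmetric] using s(1) cc y by (simp add: word_simps)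
        finally have "inv y \<in> centralizer {s \<otimes> c \<otimes> inv s}"
          using s cc y by (simp add: centralizer_def)
        then have "y \<in> centralizer {s \<otimes> c \<otimes> inv s}"
          using subgroup.m_inv_closed[OF subgroup_centralizer, of "{s \<otimes> c \<otimes> inv s}" "inv y"] s cc y by simp
        then show ?thesis using centralizer_sym s cc by simp
      qed
      moreover have "s \<otimes> r = (s \<otimes> c \<otimes> inv s) \<otimes> inv c" using s cc by (simp add: r_def si m_assoc)
      ultimately have vP: "s \<otimes> r \<in> ?P" using c sP by (simp add: subgroup.m_closed subgroup.m_inv_closed)
      then obtain j where "ord (s \<otimes> r) = p ^ j" using ordP by blast
      then have "odd (ord (s \<otimes> r))" using p False by (metis even_power prime_odd_nat prime_ge_2_nat le_neq_implies_less)
      then obtain k where "ord (s \<otimes> r) = Suc (2 * k)" by (metis oddE Suc_eq_plus1)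
      then have conj: "(s \<otimes> r) [^] k \<otimes> s \<otimes> inv ((s \<otimes> r) [^] k) = r"
        using involutions_conjugate_if_odd_product s r by blast
      define v where "v = (s \<otimes> r) [^] k"
      have vP: "v \<in> ?P" unfolding v_def using vP sP
        by (induction k) (auto intro: subgroup.one_closed subgroup.m_closed)
      have vc: "v \<in> carrier G" using vP by (rule centralizer_closed)
      let ?e = "inv v \<otimes> c"
      have eP: "?e \<in> ?P" using vP c sP by (simp add: subgroup.m_closed subgroup.m_inv_closed)
      have ec: "?e \<in> carrier G" using vc cc by simp
      have "?e \<otimes> s = inv v \<otimes> r \<otimes> c" unfolding r_def using s cc vc by (simp add: word_simps)
      also have "\<dots> = s \<otimes> ?e" unfolding conj[folded v_def, symmetric] using s cc vc by (simp add: word_simps)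
      \<comment> \<open>Both \<open>c\<close> and \<open>v\<close> conjugate \<open>s\<close> to \<open>r\<close>, so they differ by a \<open>p\<close>-element commuting with \<open>s\<close>.\<close>
      finally have comm: "?e \<otimes> s = s \<otimes> ?e" .
      obtain a b where "ord ?e = p ^ a" "ord s = 2 ^ b" using ordP[OF eP] ord_s by blast
      then have "?e = \<one>"
        using prime_of_commuting[of p ?e a 2 s b] p False ec s comm by auto
      then have "c = v" using vc cc by (metis inv_equality inv_inv inv_closed)
      then show ?thesis
        using involution_inverts_product[OF s(1,3) r, of k] si by (simp add: v_def)
    qed
    \<comment> \<open>Inversion is now an automorphism of \<open>P\<close>, namely conjugation by \<open>s\<close>.\<close>
    have "x \<otimes> z = z \<otimes> x" if "x \<in> ?P" "z \<in> ?P" for x z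
    proof -
      have c: "x \<in> carrier G" "z \<in> carrier G" using that centralizer_closed by auto
      have "inv z \<otimes> inv x = s \<otimes> (x \<otimes> z) \<otimes> s"
        using inv_all[of "x \<otimes> z"] that sP c by (simp add: subgroup.m_closed inv_mult_group)
      also have "\<dots> = (s \<otimes> x \<otimes> s) \<otimes> (s \<otimes> z \<otimes> s)"
        using s c inv_cancel_left[of s] by (simp add: si m_assoc)
      also have "\<dots> = inv x \<otimes> inv z" using inv_all that by simp
      finally show ?thesis using c by (metis inv_inv inv_mult_group inv_closed)
    qed
    then show ?thesis
      using p_subgroups_bounded[OF p(1)] finite_abelian_p_subgroup[OF p(1) ppP] by metis
  qed
qed

section \<open>Finiteness in the presence of an involution\<close>

text \<open>
  Almost every element is the product of an element with square \<open>\<one>\<close> and one centralizing \<open>t\<close>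
  (\<open>fact\<close> in the proof).  Applying this to \<open>s \<otimes> g\<close> for the conjugates \<open>s\<close> of \<open>t\<close> produces an element
  inverted by infinitely many involutions.
\<close>

lemma finite_carrier_if_involution:
  assumes t: "t \<in> carrier G" "t \<noteq> \<one>" "t \<otimes> t = \<one>"
  shows "finite (carrier G)"
proof (rule ccontr)
  assume inf: "infinite (carrier G)"
  let ?H = "centralizer {t}"
  have sG: "subgroup (carrier G) G" by (rule subgroup_self)
  have sH: "subgroup ?H G" using t by (intro subgroup_centralizer) auto
  have finH: "finite ?H" using t by (rule finite_centralizer_involution)
  have fib: "finite {x \<in> carrier G. x \<otimes> t \<otimes> inv x \<in> S}" if "finite S" for S
    using that finH by (intro finite_conj_preimage[OF sG t(1)]) auto
  define K where "K = {x \<otimes> t \<otimes> inv x | x. x \<in> carrier G}"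
  have K: "s \<in> carrier G" "s \<noteq> \<one>" "s \<otimes> s = \<one>" if sK: "s \<in> K" for s
  proof -
    obtain x where x: "x \<in> carrier G" "s = x \<otimes> t \<otimes> inv x" using sK by (auto simp: K_def)
    show sc: "s \<in> carrier G" using x t by simp
    have "s \<otimes> s = x \<otimes> (t \<otimes> t) \<otimes> inv x" using x t(1) by (simp add: word_simps)
    then show "s \<otimes> s = \<one>" using x t by simp
    have "t = inv x \<otimes> s \<otimes> x" using x t(1) by (simp add: word_simps)
    then show "s \<noteq> \<one>" using t x by auto
  qed
  have infK: "infinite K"
  proof
    assume "finite K"
    then have "finite {x \<in> carrier G. x \<otimes> t \<otimes> inv x \<in> K}" by (rule fib)
    moreover have "{x \<in> carrier G. x \<otimes> t \<otimes> inv x \<in> K} = carrier G" by (auto simp: K_def)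
    ultimately show False using inf by simp
  qed
  \<comment> \<open>The conjugates \<open>s\<close> of \<open>t\<close> for which \<open>t \<otimes> s\<close> has even order or is trivial all lie in \<open>S\<close>.\<close>
  define S where "S = insert t (\<Union>z \<in> {z \<in> ?H. z \<noteq> \<one> \<and> z \<otimes> z = \<one>}. centralizer {z})"
  have finS: "finite S" unfolding S_def
    using finH finite_centralizer_involution by (auto intro: centralizer_closed)
  define B where "B = {x \<in> carrier G. x \<otimes> t \<otimes> inv x \<in> S}"
  have finB: "finite B" unfolding B_def using finS by (rule fib)
  \<comment> \<open>The element \<open>x \<otimes> inv h\<close> is the involution swapping \<open>t\<close> and its conjugate by \<open>x\<close>.\<close>
  have fact: "\<exists>h \<in> ?H. (x \<otimes> inv h) \<otimes> (x \<otimes> inv h) = \<one>" if x: "x \<in> carrier G" "x \<notin> B" for x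
  proof -
    define s where "s = x \<otimes> t \<otimes> inv x"
    have "s \<in> K" using x by (auto simp: s_def K_def)
    note s = K[OF this]
    have nS: "s \<notin> S" using x by (simp add: B_def s_def)
    define w where "w = t \<otimes> s"
    have wc: "w \<in> carrier G" using t s by (simp add: w_def)
    obtain p n where p: "Factorial_Ring.prime p" "ord w = p ^ n" using ord_prime_power wc by blast
    have "odd (ord w)"
    proof
      assume "even (ord w)"
      then have "p = 2" using p by (metis even_power prime_odd_nat prime_ge_2_nat le_neq_implies_less)
      have w1: "w \<noteq> \<one>" using \<open>even (ord w)\<close> by auto
      have "w [^] ((2::nat) ^ n) \<in> {\<one>}" using p \<open>p = 2\<close> wc by (metis pow_ord_eq_1 singletonI)
      then obtain m where m: "w [^] ((2::nat) ^ m) \<notin> {\<one>}"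
        "w [^] ((2::nat) ^ m) \<otimes> w [^] ((2::nat) ^ m) \<in> {\<one>}"
        using last_power_of_two_outside[of w "{\<one>}" n] wc w1 by auto
      define z where "z = w [^] ((2::nat) ^ m)"
      have z: "z \<in> carrier G" "z \<noteq> \<one>" "z \<otimes> z = \<one>" using m wc by (auto simp: z_def)
      have iz: "inv z = z" using z by (simp add: inv_involution)
      have tz: "t \<otimes> z \<otimes> inv t = z"
        using involution_inverts_product[OF t(1,3) s(1,3), of "2 ^ m"] iz by (simp add: z_def w_def)
      then have tz': "t \<otimes> z = z \<otimes> t" using t z by (metis inv_solve_right' m_closed)
      have "z \<in> ?H" using z tz' by (simp add: centralizer_def)
      moreover have "s \<in> centralizer {z}"
      proof -
        have "s = t \<otimes> w" using t s by (simp add: w_def flip: m_assoc)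
        moreover have "t \<in> centralizer {z}" using t tz' by (simp add: centralizer_def)
        moreover have "w \<in> centralizer {z}"
          unfolding z_def using wc by (intro centralizer_pow) (auto simp: centralizer_def)
        ultimately show ?thesis
          using subgroup.m_closed[OF subgroup_centralizer[of "{z}"]] z by simp
      qed
      ultimately have "s \<in> S" using z by (auto simp: S_def)
      then show False using nS by blast
    qed
    then obtain k where k: "ord w = Suc (2 * k)" by (metis oddE Suc_eq_plus1)
    define v where "v = w [^] k"
    have vc: "v \<in> carrier G" using wc by (simp add: v_def)
    have it: "inv t = t" using t by (simp add: inv_involution)
    have conj: "v \<otimes> t \<otimes> inv v = s"
      using involutions_conjugate_if_odd_product[OF t(1,3) s(1,3)] k by (simp add: v_def w_def)
    have tv: "t \<otimes> v \<otimes> inv t = inv v"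
      using involution_inverts_product[OF t(1,3) s(1,3), of k] by (simp add: v_def w_def)
    define u where "u = v \<otimes> t"
    have uc: "u \<in> carrier G" using vc t by (simp add: u_def)
    have "u \<otimes> u = v \<otimes> (t \<otimes> v \<otimes> inv t)" using vc t(1) by (simp add: u_def it m_assoc)
    then have uu: "u \<otimes> u = \<one>" unfolding tv using vc by simp
    let ?h = "inv u \<otimes> x"
    have "inv u \<otimes> s \<otimes> u = t" unfolding conj[symmetric] u_def using vc t(1) by (simp add: word_simps)
    have "?h \<otimes> t = inv u \<otimes> s \<otimes> x" unfolding s_def using x t uc by (simp add: word_simps)
    also have "\<dots> = (inv u \<otimes> s \<otimes> u) \<otimes> ?h" using x s uc by (simp add: word_simps)
    also have "\<dots> = t \<otimes> ?h" unfolding \<open>inv u \<otimes> s \<otimes> u = t\<close> ..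
    finally have "?h \<in> ?H" using x uc by (simp add: centralizer_def)
    moreover have "x \<otimes> inv ?h = u" using x uc by (simp add: word_simps)
    ultimately show ?thesis using uu by (intro bexI[of _ ?h]) simp_all
  qed
  obtain g where g: "g \<in> carrier G" "g \<notin> ?H" using inf finH by (meson finite_subset subsetI)
  \<comment> \<open>The conjugates of \<open>t\<close> that invert \<open>g \<otimes> inv h\<close>.\<close>
  define L where "L h = {s \<in> K. (s \<otimes> (g \<otimes> inv h)) \<otimes> (s \<otimes> (g \<otimes> inv h)) = \<one>}" for h
  have "K \<subseteq> (\<lambda>b. b \<otimes> inv g) ` B \<union> (\<Union>h\<in>?H. L h)"
  proof
    fix s assume sK: "s \<in> K"
    note s = K[OF sK]
    show "s \<in> (\<lambda>b. b \<otimes> inv g) ` B \<union> (\<Union>h\<in>?H. L h)"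
    proof (cases "s \<otimes> g \<in> B")
      case True
      moreover have "s = (s \<otimes> g) \<otimes> inv g" using s g by (simp add: m_assoc)
      ultimately show ?thesis by blast
    next
      case False
      then obtain h where h: "h \<in> ?H" "(s \<otimes> g \<otimes> inv h) \<otimes> (s \<otimes> g \<otimes> inv h) = \<one>"
        using fact[of "s \<otimes> g"] s g by auto
      moreover have "s \<otimes> g \<otimes> inv h = s \<otimes> (g \<otimes> inv h)"
        using s g centralizer_closed[OF h(1)] by (simp add: m_assoc)
      ultimately have "s \<in> L h" using sK by (simp add: L_def)
      then show ?thesis using h(1) by blast
    qed
  qed
  then have "\<not> (\<forall>h\<in>?H. finite (L h))"
    using infK finB finH by (meson finite_UN_I finite_Un finite_imageI finite_subset)
  then obtain h where h: "h \<in> ?H" "infinite (L h)" by blast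
  define y where "y = g \<otimes> inv h"
  have hc: "h \<in> carrier G" using h(1) by (rule centralizer_closed)
  have yc: "y \<in> carrier G" using g hc by (simp add: y_def)
  have "y \<noteq> \<one>"
  proof
    assume "y = \<one>"
    then have "g = h" using g hc by (metis inv_equality inv_inv inv_closed y_def)
    then show False using g h by simp
  qed
  have L: "s \<otimes> y \<otimes> s = inv y" if "s \<in> L h" for s
  proof -
    have sK: "s \<in> K" and e: "(s \<otimes> y) \<otimes> (s \<otimes> y) = \<one>" using that by (simp_all add: L_def y_def)
    have "(s \<otimes> y \<otimes> s) \<otimes> y = \<one>" using e K[OF sK] yc by (simp add: m_assoc)
    then show ?thesis using K[OF sK] yc inv_equality[of "s \<otimes> y \<otimes> s" y] by simp
  qed
  obtain s0 where s0: "s0 \<in> L h" using h(2) by (metis finite.emptyI equals0I)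
  have s0K: "s0 \<in> K" using s0 by (simp add: L_def)
  note s0' = K[OF s0K]
  have "(\<lambda>s. s0 \<otimes> s) ` L h \<subseteq> centralizer {y}"
  proof (clarify)
    fix s assume sL: "s \<in> L h"
    then have "s \<in> K" by (simp add: L_def)
    note s = K[OF this]
    have i: "inv s = s" "inv s0 = s0" using s s0' by (simp_all add: inv_involution)
    have "y = inv (s \<otimes> y \<otimes> s)" using L[OF sL] yc by simp
    also have "\<dots> = s \<otimes> inv y \<otimes> s" using s yc by (simp add: inv_mult_group i m_assoc)
    also have "\<dots> = s \<otimes> (s0 \<otimes> y \<otimes> s0) \<otimes> s" unfolding L[OF s0] ..
    finally have eq: "y = s \<otimes> (s0 \<otimes> y \<otimes> s0) \<otimes> s" .
    have "(s0 \<otimes> s) \<otimes> y = (s0 \<otimes> s) \<otimes> (s \<otimes> (s0 \<otimes> y \<otimes> s0) \<otimes> s)" using eq by simp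
    also have "\<dots> = y \<otimes> (s0 \<otimes> s)"
      using s s0' yc inv_cancel_left[of s] inv_cancel_left[of s0] by (simp add: m_assoc i)
    finally show "s0 \<otimes> s \<in> centralizer {y}" using s s0' by (simp add: centralizer_def)
  qed
  moreover have "inj_on (\<lambda>s. s0 \<otimes> s) (L h)"
  proof (rule inj_onI)
    fix a b assume "a \<in> L h" "b \<in> L h" "s0 \<otimes> a = s0 \<otimes> b"
    then show "a = b" using K s0' by (auto simp: L_def)
  qed
  ultimately have "infinite (centralizer {y})"
    using h(2) by (meson finite_imageD finite_subset)
  moreover have "finite (centralizer {y})"
    using finite_centralizer_inverted[OF s0' yc \<open>y \<noteq> \<one>\<close>] L[OF s0] s0'
    by (simp add: inv_involution)
  ultimately show False by simp
qed

end

lemma bounded_eppo_group_if_BSP_group: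
  fixes G (structure)
  assumes "BSP_group G"
  shows "bounded_eppo_group G"
proof -
  interpret group G using assms by (simp add: BSP_group_def)
  show ?thesis
  proof
    show "\<exists>p n. Factorial_Ring.prime p \<and> ord x = p ^ n" if "x \<in> carrier G" for x
      using assms that by (simp add: BSP_group_def)
  next
    fix p :: nat assume p: "Factorial_Ring.prime p"
    show "\<exists>N. \<forall>F. p_subgroup p F G \<and> finite F \<longrightarrow> card F \<le> N"
    proof (cases "p \<in> group_primes G")
      case True
      then obtain v where "\<forall>H. p_subgroup p H G \<and> finite H \<longrightarrow> (\<exists>j. card H = p ^ j \<and> p ^ j \<le> p ^ v)"
        using assms unfolding BSP_group_def by blast
      then show ?thesis by (intro exI[of _ "p ^ v"]) metis
    next
      case False
      have "F \<subseteq> {\<one>}" if F: "p_subgroup p F G" for F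
      proof
        fix x assume x: "x \<in> F"
        then obtain k where k: "ord x = p ^ k" using F by (auto simp: p_subgroup_def)
        have xc: "x \<in> carrier G" using F x subgroup.mem_carrier by (auto simp: p_subgroup_def)
        have "k = 0"
        proof (rule ccontr)
          assume "k \<noteq> 0"
          then have "p dvd ord x" "ord x \<noteq> 0" using k p by (auto simp: prime_gt_0_nat)
          then show False using False p xc by (auto simp: group_primes_def)
        qed
        then show "x \<in> {\<one>}" using k ord_eq_1[OF xc] by simp
      qed
      then have "card F \<le> 1" if "p_subgroup p F G" for F
        using that card_mono[of "{\<one>}" F] by auto
      then show ?thesis by blast
    qed
  qed
qed

theorem theorem9:
  fixes G :: "('a, 'b) monoid_scheme"
  assumes "BSP_group G"
    and "2 \<in> group_primes G"
  shows "locally_finite_group G"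
proof -
  interpret bounded_eppo_group G using assms(1) by (rule bounded_eppo_group_if_BSP_group)
  obtain x where x: "x \<in> carrier G" "group.ord G x \<noteq> 0" "2 dvd group.ord G x"
    using assms(2) by (auto simp: group_primes_def)
  obtain k where k: "group.ord G x = 2 * k" using x(3) by (rule dvdE)
  let ?t = "x [^]\<^bsub>G\<^esub> k"
  have "?t \<noteq> \<one>\<^bsub>G\<^esub>" using x k by (auto simp: pow_eq_id dest: dvd_imp_le)
  moreover have "?t \<otimes>\<^bsub>G\<^esub> ?t = \<one>\<^bsub>G\<^esub>" using x(1) k by (simp add: nat_pow_mult pow_eq_id flip: mult_2)
  ultimately have "finite (carrier G)" using x(1) by (intro finite_carrier_if_involution) auto
  then show ?thesis
    unfolding locally_finite_group_def finitely_generated_subgroup_def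
    using is_group by (auto dest: subgroup.subset intro: finite_subset)
qed

end
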